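(* Let $x,\nu$ be complex parameters and let $S=(S_n)_{n \geqslant 1}$ and $T=(T_n)_{n \geqslant 1}$ be complex sequences such that $S = B(x,\nu) \cdot T$, equivalently $T = A(x,\nu) \cdot S$. Denote by $\mathfrak{G}_S(z) = \sum_{n\geqslant 1} S_n z^n$ and $\mathfrak{G}_T(z)=\sum_{n \geqslant 1} T_n z^n$ the formal ordinary generating series of $S$ and $T$. Define the mapping $\Xi$ by $$ \Xi(z) = \frac{z}{z-1}\Bigl(\frac{1-z}{1-z(1-x)}\Bigr)^{\nu}. $$ Then $$ \mathfrak{G}_S(z) = \left [ \frac{1-\nu}{1-z} + \frac{\nu}{1-z(1-x)} \right ] \mathfrak{G}_T(\Xi(z)). $$ Conversely, $\mathfrak{G}_T$ is given in terms of $\mathfrak{G}_S$ by $$ \mathfrak{G}_T(\xi) = \mathfrak{G}_S(\Omega(\xi)) \left [ \frac{1-\nu}{1-\Omega(\xi)} + \frac{\nu}{1-(1-x)\Omega(\xi)} \right ]^{-1} $$ where $\Omega$ is the inverse mapping of $\Xi$, i.e. $\Xi(z) = \xi \Leftrightarrow z = \Omega(\xi)$ (near $0$, with $\Omega(0)=0$).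
   Context: $A(x,\nu)$ and $B(x,\nu)$ are the infinite lower-triangular matrices, indexed by integers $n,k\geqslant 1$, with entries $$A_{n,k}(x,\nu) = (-1)^k\binom{n}{k}F(k-n,-n\nu;-n;x), \qquad B_{n,k}(x,\nu) = (-1)^k\binom{n}{k}F(k-n,k\nu;k;x)$$ for $1 \leqslant k \leqslant n$ (zero for $k>n$), where $F$ is the Gauss hypergeometric function, here the polynomials $F(k-n,-n\nu;-n;x) = \sum_{m=0}^{n-k} \frac{(k-n)_m(-n\nu)_m}{(-n)_m m!} x^m$ and $F(k-n,k\nu;k;x) = \sum_{m=0}^{n-k} \frac{(k-n)_m(k\nu)_m}{(k)_m m!} x^m$, with $(c)_m = c(c+1)\cdots(c+m-1)$, $(c)_0=1$. These matrices are inverse of each other. The power in $\Xi$ is the branch equal to $1$ at $z=0$; $\Xi$ is analytic near $0$ with $\Xi(0)=0$, $\Xi'(0)=-1$, so it has an analytic local inverse at $0$. The relations are identities of formal power series (in $z$, resp. $\xi$), with $\Xi$ and $\Omega$ identified with their expansions at $0$. *)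

theory Defs
  imports "HOL-Complex_Analysis.Complex_Analysis"
begin

(* The Gauss hypergeometric polynomial F(-d, b; c; x). The series is cut off at m = d by
   definition, so that it is meaningful for c = -n with n > d, where the denominators
   (c)_m, m <= d, do not vanish although (c)_m = 0 for m > n. *)
definition hyp_poly :: "nat \<Rightarrow> complex \<Rightarrow> complex \<Rightarrow> complex \<Rightarrow> complex" where
  "hyp_poly d b c x =
     (\<Sum>m=0..d. pochhammer (- of_nat d) m * pochhammer b m / (pochhammer c m * fact m) * x ^ m)"

definition matA :: "complex \<Rightarrow> complex \<Rightarrow> nat \<Rightarrow> nat \<Rightarrow> complex" where
  "matA x \<nu> n k =
     (if 1 \<le> k \<and> k \<le> n
      then (-1) ^ k * of_nat (n choose k) * hyp_poly (n - k) (- of_nat n * \<nu>) (- of_nat n) x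
      else 0)"

definition matB :: "complex \<Rightarrow> complex \<Rightarrow> nat \<Rightarrow> nat \<Rightarrow> complex" where
  "matB x \<nu> n k =
     (if 1 \<le> k \<and> k \<le> n
      then (-1) ^ k * of_nat (n choose k) * hyp_poly (n - k) (of_nat k * \<nu>) (of_nat k) x
      else 0)"

(* The n-th entry of the product of a lower-triangular matrix M, indexed from 1, with a column
   vector V; entries of V at index 0 are junk and never used. *)
definition lower_mult :: "(nat \<Rightarrow> nat \<Rightarrow> complex) \<Rightarrow> (nat \<Rightarrow> complex) \<Rightarrow> nat \<Rightarrow> complex" where
  "lower_mult M V n = (\<Sum>k=1..n. M n k * V k)"

definition gen_series :: "(nat \<Rightarrow> complex) \<Rightarrow> complex fps" where
  "gen_series V = Abs_fps (\<lambda>n. if n = 0 then 0 else V n)"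

(* The base of the power is 1 at z = 0, so the principal branch used by powr is, near 0, the
   analytic branch equal to 1 at z = 0. *)
definition Xi :: "complex \<Rightarrow> complex \<Rightarrow> complex \<Rightarrow> complex" where
  "Xi x \<nu> z = z / (z - 1) * ((1 - z) / (1 - z * (1 - x))) powr \<nu>"

definition local_inverse_at_0 :: "(complex \<Rightarrow> complex) \<Rightarrow> (complex \<Rightarrow> complex) \<Rightarrow> bool" where
  "local_inverse_at_0 f g \<longleftrightarrow>
     g analytic_on {0} \<and> g 0 = 0 \<and>
     (\<exists>U V. open U \<and> 0 \<in> U \<and> open V \<and> 0 \<in> V \<and> (\<forall>z\<in>U. \<forall>\<xi>\<in>V. f z = \<xi> \<longleftrightarrow> z = g \<xi>))"

end

theory Submission
  imports Defs
begin

text \<open>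
  Everything rests on reading the columns of \<open>B\<close> and the rows of \<open>A\<close> off the one series
  \<open>\<Xi>(z) = z H(z)\<close>. Since \<open>(1 - z (1 - x)) / (1 - z) = 1 + x y\<close> with \<open>y = z / (1 - z)\<close>, one has
  \<open>\<Xi> = - y (1 + x y) powr (- \<nu>)\<close>, so expanding powers of \<open>\<Xi>\<close> by the binomial series in \<open>x y\<close> and
  then powers of \<open>y\<close> in \<open>z\<close> reproduces the hypergeometric sums:
  \<open>B n k = (n / k) [z^n] \<Xi>^k\<close> (lemma \<open>matB_eq\<close>) and \<open>A n k = [z^(n - k)] H^(- n)\<close>
  (lemma \<open>matA_eq\<close>).

  That \<open>A\<close> and \<open>B\<close> are inverse to each other is then the orthogonality behind Lagrange inversion:
  the sum of \<open>A n j * B j k\<close> over \<open>j\<close> is \<open>1 / k\<close> times the \<open>n\<close>-th coefficient of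
  \<open>H^(- n) * z * (d/dz) \<Xi>^k\<close>, in other words the residue of \<open>\<Xi>^(k - n - 1) d\<Xi>\<close>, which
  vanishes for \<open>k \<noteq> n\<close> because the differential is exact (lemma \<open>lagrange_biorthogonality\<close>).

  For the generating series, the rational weight in the theorem is the logarithmic derivative
  \<open>z \<Xi>' / \<Xi>\<close> (lemma \<open>weight_mult_Xi\<close>). The weight times \<open>\<Xi>^k\<close> is therefore
  \<open>(1 / k) z (d/dz) \<Xi>^k\<close>, which is the generating series of the \<open>k\<close>-th column of \<open>B\<close>; summing
  these columns against \<open>T k\<close> gives the first relation (lemma \<open>gen_series_matB\<close>). The second one
  follows by substituting \<open>\<Omega>\<close>, whose expansion is a compositional inverse of that of \<open>\<Xi>\<close> (lemma
  \<open>local_inverse_expansion\<close>), and dividing by the weight, whose constant term is 1.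
\<close>

no_notation vec_nth (infixl "$" 90)

section \<open>Formal power series: composition and Lagrange inversion\<close>

text \<open>A composition is an infinite sum of powers of \<open>Y\<close>, of which only the first \<open>n + 1\<close> contribute
  in degree \<open>n\<close>; hence multiplication by \<open>A\<close> may be carried out term by term.\<close>

lemma mult_compose_nth:
  fixes A f Y :: "'a::idom fps"
  assumes "Y $ 0 = 0"
  shows "(A * (f oo Y)) $ n = (\<Sum>m=0..n. f $ m * (A * Y ^ m) $ n)"
proof -
  have trunc: "(f oo Y) $ j = (\<Sum>m=0..n. f $ m * (Y ^ m) $ j)" if "j \<le> n" for j
    unfolding fps_compose_nth
    by (rule sum.mono_neutral_left) (use that startsby_zero_power_prefix[OF assms] in auto)
  have "(A * (f oo Y)) $ n = (\<Sum>i=0..n. A $ i * (\<Sum>m=0..n. f $ m * (Y ^ m) $ (n - i)))"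
    unfolding fps_mult_nth by (intro sum.cong refl) (simp add: trunc)
  also have "\<dots> = (\<Sum>m=0..n. \<Sum>i=0..n. f $ m * (A $ i * (Y ^ m) $ (n - i)))"
    unfolding sum_distrib_left by (subst sum.swap) (simp only: mult.left_commute)
  finally show ?thesis
    by (simp add: fps_mult_nth sum_distrib_left)
qed

text \<open>Here \<open>G\<close> is the reciprocal of \<open>H\<close>. With \<open>F = z H\<close>, the coefficient is the residue of
  \<open>F^(- n) d(F^k) = k F^(k - n - 1) dF\<close>. For \<open>d = n - k > 0\<close> this differential is exact, which
  in terms of \<open>G\<close> alone says that \<open>d (G^d + z G^(d + 1) H')\<close> equals \<open>d G^d - z (G^d)'\<close>, a series
  whose coefficient in degree \<open>d\<close> cancels. For \<open>d = 0\<close> only the constant term counts.\<close>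

lemma lagrange_biorthogonality:
  fixes H G :: "'a::field_char_0 fps"
  assumes GH: "G * H = 1" and k: "1 \<le> k" "k \<le> n"
  shows "(G ^ n * (fps_X * fps_deriv ((fps_X * H) ^ k))) $ n = (if n = k then of_nat k else 0)"
proof -
  define d where "d = n - k"
  have n: "n = d + k" using k by (simp add: d_def)
  obtain k' where k': "k = Suc k'" using k by (cases k) auto
  have GH': "G ^ j * H ^ j = 1" for j
    by (metis GH power_mult_distrib power_one)
  have dG: "fps_deriv G = - (G * G * fps_deriv H)"
  proof -
    have "fps_deriv G * H + G * fps_deriv H = 0"
      using arg_cong[OF GH, of fps_deriv] by (simp add: add.commute mult.commute)
    hence "G * (fps_deriv G * H + G * fps_deriv H) = 0" by simp
    hence "fps_deriv G * (G * H) + G * G * fps_deriv H = 0" by (simp add: algebra_simps)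
    thus ?thesis using GH by (simp add: eq_neg_iff_add_eq_0)
  qed
  have eq: "G ^ n * (fps_X * fps_deriv ((fps_X * H) ^ k))
      = of_nat k * (fps_X ^ k * (G ^ d + fps_X * (G ^ Suc d * fps_deriv H)))"
  proof -
    have der: "fps_deriv ((fps_X * H) ^ k)
        = of_nat k * ((H + fps_X * fps_deriv H) * (fps_X * H) ^ k')"
      unfolding fps_deriv_power' by (simp add: k' algebra_simps del: of_nat_Suc)
    have "G ^ n * (fps_X * fps_deriv ((fps_X * H) ^ k))
        = of_nat k * fps_X ^ k * (G ^ d * (G ^ k * H ^ k)
            + fps_X * (G ^ Suc d * (G ^ k' * H ^ k') * fps_deriv H))"
      unfolding n der by (simp add: k' power_mult_distrib power_add algebra_simps del: of_nat_Suc)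
    thus ?thesis by (simp add: GH' mult.assoc)
  qed
  show ?thesis
  proof (cases "d = 0")
    case True
    hence "n = k" by (simp add: n)
    moreover have "(of_nat k * (fps_X ^ k * (G ^ d + fps_X * (G ^ Suc d * fps_deriv H)))) $ k
        = of_nat k"
      by (simp add: True fps_of_nat[symmetric] fps_X_power_mult_nth del: fps_of_nat)
    ultimately show ?thesis using eq by simp
  next
    case False
    then obtain d' where d': "d = Suc d'" by (cases d) auto
    have "of_nat d * (G ^ d + fps_X * (G ^ Suc d * fps_deriv H))
        = of_nat d * G ^ d - fps_X * fps_deriv (G ^ d)"
      unfolding fps_deriv_power' by (simp add: d' dG algebra_simps del: of_nat_Suc)
    moreover have "(fps_X * fps_deriv (G ^ d)) $ d = of_nat d * (G ^ d) $ d"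
      using False by simp
    moreover have "(of_nat d * G ^ d) $ d = of_nat d * (G ^ d) $ d"
      by (simp add: fps_of_nat[symmetric] del: fps_of_nat)
    ultimately have "(of_nat d * (G ^ d + fps_X * (G ^ Suc d * fps_deriv H))) $ d = 0"
      by simp
    hence "(G ^ d + fps_X * (G ^ Suc d * fps_deriv H)) $ d = 0"
      using False by (simp add: fps_of_nat[symmetric] del: fps_of_nat)
    hence "(of_nat k * (fps_X ^ k * (G ^ d + fps_X * (G ^ Suc d * fps_deriv H)))) $ n = 0"
      by (simp add: n fps_of_nat[symmetric] fps_X_power_mult_nth del: fps_of_nat)
    thus ?thesis using eq False n by simp
  qed
qed

section \<open>The expansions of \<open>\<Xi>\<close> and of its building blocks\<close>

definition Y_fps :: "complex fps" where
  "Y_fps = fps_X * inverse (1 - fps_X)"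

text \<open>The binomial series of \<open>(1 + x y) powr a\<close>, where \<open>y = z / (1 - z)\<close>.\<close>

definition bin_fps :: "complex \<Rightarrow> complex \<Rightarrow> complex fps" where
  "bin_fps x a = fps_binomial a oo (fps_const x * Y_fps)"

lemma Y_fps_0 [simp]: "Y_fps $ 0 = 0"
  by (simp add: Y_fps_def)

lemma inverse_one_minus_X: "(1 - fps_X) * inverse (1 - fps_X) = (1 :: complex fps)"
  by (simp add: inverse_mult_eq_1')

lemma bin_fps_nth_0 [simp]: "bin_fps x a $ 0 = 1"
  by (simp add: bin_fps_def)

lemma bin_fps_add: "bin_fps x (a + b) = bin_fps x a * bin_fps x b"
  by (simp add: bin_fps_def fps_binomial_add_mult fps_compose_mult_distrib)

lemma bin_fps_0: "bin_fps x 0 = 1"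
  by (simp add: bin_fps_def)

lemma bin_fps_power: "bin_fps x a ^ n = bin_fps x (of_nat n * a)"
  by (simp add: bin_fps_def fps_compose_power fps_binomial_power)

text \<open>Moves the scaling by \<open>x\<close> into the coefficients, so that \<open>mult_compose_nth\<close> produces powers of
  \<open>y\<close> only.\<close>

lemma bin_fps_conv_compose:
  "bin_fps x a = Abs_fps (\<lambda>m. x ^ m * (a gchoose m)) oo Y_fps"
proof -
  have "bin_fps x a = fps_binomial a oo ((fps_const x * fps_X) oo Y_fps)"
    by (simp add: bin_fps_def fps_compose_mult_distrib)
  also have "\<dots> = (fps_binomial a oo (fps_const x * fps_X)) oo Y_fps"
    by (rule fps_compose_assoc) auto
  finally show ?thesis by (simp add: fps_compose_linear)
qed

lemma Y_power_nth:
  assumes "1 \<le> i" "i \<le> n"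
  shows "(Y_fps ^ i) $ n = of_nat ((n - 1) choose (i - 1))"
proof -
  have "Y_fps ^ i = fps_X ^ i * inverse ((1 - fps_const 1 * fps_X) ^ i)"
    by (simp add: Y_fps_def power_mult_distrib fps_inverse_power)
  also have "\<dots> = fps_X ^ i * (fps_binomial (- of_nat i) oo (fps_const (-1) * fps_X))"
    by (subst one_minus_fps_X_const_neg_power) (simp flip: fps_const_neg)
  finally have "(Y_fps ^ i) $ n = (-1) ^ (n - i) * ((- of_nat i) gchoose (n - i))"
    using assms by (simp add: fps_compose_linear fps_X_power_mult_nth)
  also have "\<dots> = (of_nat i + of_nat (n - i) - 1) gchoose (n - i)"
    by (subst gbinomial_minus) (simp add: power_mult_distrib[symmetric] mult.assoc[symmetric])
  also have "(of_nat i + of_nat (n - i) - 1 :: complex) = of_nat (n - 1)"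
    using assms by (simp add: of_nat_diff)
  also have "of_nat (n - 1) gchoose (n - i) = (of_nat ((n - 1) choose (n - i)) :: complex)"
    by (simp add: binomial_gbinomial)
  also have "(n - 1) choose (n - i) = (n - 1) choose (i - 1)"
    using assms by (subst binomial_symmetric) (auto intro!: arg_cong[of _ _ "\<lambda>j. (n-1) choose j"])
  finally show ?thesis .
qed

lemma one_minus_X_power_nth:
  "((1 - fps_X) ^ n) $ j = (-1) ^ j * (of_nat (n choose j) :: complex)"
proof -
  have "(1 - fps_const 1 * fps_X :: complex fps) ^ n
      = fps_binomial (of_nat n) oo (fps_const (-1) * fps_X)"
    by (subst one_minus_const_fps_X_power) (auto simp flip: fps_const_neg)
  thus ?thesis by (simp add: fps_compose_linear binomial_gbinomial)
qed

definition H_fps :: "complex \<Rightarrow> complex \<Rightarrow> complex fps" where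
  "H_fps x \<nu> = - (inverse (1 - fps_X) * bin_fps x (- \<nu>))"

text \<open>The reciprocal of \<open>H_fps\<close>, written with \<open>\<nu>\<close> in place of \<open>- \<nu>\<close> so that its powers
  expand directly.\<close>

definition G_fps :: "complex \<Rightarrow> complex \<Rightarrow> complex fps" where
  "G_fps x \<nu> = - ((1 - fps_X) * bin_fps x \<nu>)"

definition Xi_fps :: "complex \<Rightarrow> complex \<Rightarrow> complex fps" where
  "Xi_fps x \<nu> = fps_X * H_fps x \<nu>"

lemma Xi_fps_0 [simp]: "Xi_fps x \<nu> $ 0 = 0"
  by (simp add: Xi_fps_def)

lemma G_H: "G_fps x \<nu> * H_fps x \<nu> = 1"
proof -
  have "G_fps x \<nu> * H_fps x \<nu>
      = ((1 - fps_X) * inverse (1 - fps_X)) * (bin_fps x \<nu> * bin_fps x (-\<nu>))"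
    by (simp add: G_fps_def H_fps_def algebra_simps)
  thus ?thesis
    by (simp add: inverse_one_minus_X bin_fps_add[symmetric] bin_fps_0)
qed

section \<open>The matrix entries as power series coefficients\<close>

lemma pochhammer_neg_nat:
  assumes "m \<le> d"
  shows "pochhammer (- of_nat d) m = (-1) ^ m * fact d / (fact (d - m) :: complex)"
proof -
  have "fact d = pochhammer (1::complex) (d - m) * pochhammer (1 + of_nat (d - m)) m"
    using assms by (subst pochhammer_product'[symmetric]) (simp add: pochhammer_fact)
  hence "fact d = fact (d - m) * pochhammer (of_nat d - of_nat m + 1 :: complex) m"
    using assms by (simp add: pochhammer_fact[symmetric] of_nat_diff algebra_simps)
  thus ?thesis by (simp add: pochhammer_minus)
qed

lemma pochhammer_pos_nat:
  assumes "1 \<le> k"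
  shows "pochhammer (of_nat k) m = fact (k + m - 1) / (fact (k - 1) :: complex)"
proof -
  have "fact (k - 1 + m) = pochhammer (1::complex) (k - 1) * pochhammer (1 + of_nat (k - 1)) m"
    by (subst pochhammer_product'[symmetric]) (simp add: pochhammer_fact)
  thus ?thesis using assms by (simp add: pochhammer_fact[symmetric] of_nat_diff)
qed

text \<open>By the binomial series, \<open>\<Xi>^k = (-1)^k (\<Sum>m. (- k \<nu> gchoose m) x^m y^(k + m))\<close>, and the
  coefficient of \<open>z^n\<close> in \<open>y^(k + m)\<close> is \<open>(n - 1) choose (k + m - 1)\<close>. What remains is to
  recognise the factorials in the terms of the hypergeometric polynomial.\<close>

lemma matB_eq:
  assumes k: "1 \<le> k" and "1 \<le> n"
  shows "matB x \<nu> n k = of_nat n / of_nat k * (Xi_fps x \<nu> ^ k) $ n"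
proof (cases "k \<le> n")
  case False
  thus ?thesis by (simp add: matB_def startsby_zero_power_prefix)
next
  case True
  define f where "f = Abs_fps (\<lambda>m. x ^ m * ((- (of_nat k * \<nu>)) gchoose m))"
  have "Xi_fps x \<nu> ^ k = (fps_const (-1) * (Y_fps * bin_fps x (- \<nu>))) ^ k"
    by (simp add: Xi_fps_def H_fps_def Y_fps_def mult.assoc flip: fps_const_neg)
  also have "\<dots> = fps_const ((-1) ^ k) * (Y_fps ^ k * bin_fps x (- (of_nat k * \<nu>)))"
    by (simp only: power_mult_distrib bin_fps_power fps_const_power mult_minus_right)
  finally have "(Xi_fps x \<nu> ^ k) $ n = (-1) ^ k * (Y_fps ^ k * (f oo Y_fps)) $ n"
    by (simp add: f_def bin_fps_conv_compose)
  also have "(Y_fps ^ k * (f oo Y_fps)) $ n = (\<Sum>m=0..n. f $ m * (Y_fps ^ (k + m)) $ n)"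
    by (simp add: mult_compose_nth power_add)
  also have "\<dots> = (\<Sum>m=0..n - k. f $ m * (Y_fps ^ (k + m)) $ n)"
    by (rule sum.mono_neutral_right) (use True in \<open>auto simp: startsby_zero_power_prefix\<close>)
  finally have Xi_nth: "(Xi_fps x \<nu> ^ k) $ n
      = (-1) ^ k * (\<Sum>m=0..n - k. f $ m * (Y_fps ^ (k + m)) $ n)" .
  have "of_nat n / of_nat k * (f $ m * (Y_fps ^ (k + m)) $ n)
      = of_nat (n choose k) * (pochhammer (- of_nat (n - k)) m * pochhammer (of_nat k * \<nu>) m
          / (pochhammer (of_nat k) m * fact m) * x ^ m)" if "m \<le> n - k" for m
  proof -
    have f: "f $ m = x ^ m * ((-1) ^ m * pochhammer (of_nat k * \<nu>) m / fact m)"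
      by (simp add: f_def gbinomial_pochhammer)
    have Y: "(Y_fps ^ (k + m)) $ n = fact (n - 1) / (fact (k + m - 1) * fact (n - k - m))"
      using that k True by (subst Y_power_nth) (auto simp: binomial_fact)
    have nn: "fact n = of_nat n * (fact (n - 1) :: complex)"
      using assms by (intro fact_reduce) auto
    have kk: "fact k = of_nat k * (fact (k - 1) :: complex)"
      using assms by (intro fact_reduce) auto
    show ?thesis
      unfolding f Y pochhammer_neg_nat[OF that] pochhammer_pos_nat[OF k] binomial_fact[OF True] nn kk
      using k by (simp add: field_simps)
  qed
  hence "of_nat n / of_nat k * (\<Sum>m=0..n - k. f $ m * (Y_fps ^ (k + m)) $ n)
      = of_nat (n choose k) * hyp_poly (n - k) (of_nat k * \<nu>) (of_nat k) x"
    unfolding hyp_poly_def sum_distrib_left by (intro sum.cong) auto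
  hence "of_nat n / of_nat k * (Xi_fps x \<nu> ^ k) $ n
      = (-1) ^ k * (of_nat (n choose k) * hyp_poly (n - k) (of_nat k * \<nu>) (of_nat k) x)"
    unfolding Xi_nth by (subst mult.left_commute) (rule arg_cong)
  thus ?thesis using k True by (simp only: matB_def if_True mult.assoc simp_thms)
qed

text \<open>With \<open>G\<close> the reciprocal of \<open>\<Xi> / z\<close>,
  \<open>G^n = (-1)^n (\<Sum>m. (n \<nu> gchoose m) x^m y^m (1 - z)^n)\<close>. For \<open>m \<le> n\<close> the product
  \<open>y^m (1 - z)^n\<close> is the polynomial \<open>z^m (1 - z)^(n - m)\<close>, whose coefficients are binomial.\<close>

lemma matA_eq:
  assumes "1 \<le> k" "k \<le> n"
  shows "matA x \<nu> n k = (G_fps x \<nu> ^ n) $ (n - k)"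
proof -
  define f where "f = Abs_fps (\<lambda>m. x ^ m * ((of_nat n * \<nu>) gchoose m))"
  have "G_fps x \<nu> = fps_const (-1) * ((1 - fps_X) * bin_fps x \<nu>)"
    by (simp add: G_fps_def flip: fps_const_neg)
  hence "G_fps x \<nu> ^ n = (fps_const (-1) * ((1 - fps_X) * bin_fps x \<nu>)) ^ n"
    by (rule arg_cong)
  also have "\<dots> = fps_const ((-1) ^ n) * ((1 - fps_X) ^ n * bin_fps x (of_nat n * \<nu>))"
    by (simp only: power_mult_distrib bin_fps_power fps_const_power)
  finally have "(G_fps x \<nu> ^ n) $ (n - k) = (-1) ^ n * ((1 - fps_X) ^ n * (f oo Y_fps)) $ (n - k)"
    by (simp add: f_def bin_fps_conv_compose)
  also have "\<dots> = (-1) ^ n * (\<Sum>m=0..n - k. f $ m * ((1 - fps_X) ^ n * Y_fps ^ m) $ (n - k))"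
    by (simp add: mult_compose_nth)
  also have "\<dots> = (\<Sum>m=0..n - k. (-1) ^ k * (of_nat (n choose k)
      * (pochhammer (- of_nat (n - k)) m * pochhammer (- of_nat n * \<nu>) m
          / (pochhammer (- of_nat n) m * fact m) * x ^ m)))"
    unfolding sum_distrib_left
  proof (intro sum.cong refl)
    fix m assume "m \<in> {0..n - k}"
    hence m: "m \<le> n - k" "m \<le> n" by auto
    have "(1 - fps_X :: complex fps) ^ n = (1 - fps_X) ^ (n - m) * (1 - fps_X) ^ m"
      using m by (simp flip: power_add)
    hence "(1 - fps_X) ^ n * Y_fps ^ m
        = fps_X ^ m * ((1 - fps_X) ^ (n - m) * ((1 - fps_X) * inverse (1 - fps_X)) ^ m)"
      unfolding Y_fps_def power_mult_distrib by (simp only: mult_ac)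
    hence "((1 - fps_X) ^ n * Y_fps ^ m) $ (n - k)
        = (-1) ^ (n - k - m) * of_nat ((n - m) choose (n - k - m))"
      using m by (simp add: inverse_one_minus_X fps_X_power_mult_nth one_minus_X_power_nth)
    also have "of_nat ((n - m) choose (n - k - m)) = (fact (n - m) / (fact (n - k - m) * fact k) :: complex)"
      using m assms by (subst binomial_fact) auto
    finally have Y: "((1 - fps_X) ^ n * Y_fps ^ m) $ (n - k)
        = (-1) ^ (n - k - m) * (fact (n - m) / (fact (n - k - m) * fact k))" .
    have f: "f $ m = x ^ m * ((-1) ^ m * pochhammer (- of_nat n * \<nu>) m / fact m)"
      by (simp add: f_def gbinomial_pochhammer)
    have sgn: "(-1) ^ n * ((-1) ^ m * (-1) ^ (n - k - m)) = ((-1) ^ k :: complex)"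
    proof -
      have "n + (m + (n - k - m)) = 2 * (n - k) + k" using m assms by simp
      hence "(-1) ^ n * ((-1) ^ m * (-1) ^ (n - k - m)) = ((-1) ^ (2 * (n - k) + k) :: complex)"
        by (simp only: power_add[symmetric])
      thus ?thesis by (simp add: power_add)
    qed
    \<comment> \<open>stated for abstract factors: the powers of \<open>-1\<close> and the factorials are only
      cancelled, and must not be expanded\<close>
    have cancel: "e / (b * c) * (p / q) * y = a / (c * d) * (s * d / b * p / (s * a / e * q) * y)"
      if "a \<noteq> 0" "d \<noteq> 0" "s \<noteq> 0" for a b c d e p q s y :: complex
      using that by (simp add: field_simps)
    have "(-1) ^ n * (f $ m * ((1 - fps_X) ^ n * Y_fps ^ m) $ (n - k))
        = ((-1) ^ n * ((-1) ^ m * (-1) ^ (n - k - m))) *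
          (fact (n - m) / (fact (n - k - m) * fact k) * (pochhammer (- of_nat n * \<nu>) m / fact m) * x ^ m)"
      unfolding f Y by (simp only: mult_ac times_divide_eq_right times_divide_eq_left)
    also have "\<dots> = (-1) ^ k * (of_nat (n choose k)
      * (pochhammer (- of_nat (n - k)) m * pochhammer (- of_nat n * \<nu>) m
          / (pochhammer (- of_nat n) m * fact m) * x ^ m))"
      unfolding sgn pochhammer_neg_nat[OF m(1)] pochhammer_neg_nat[OF m(2)] binomial_fact[OF assms(2)]
      by (rule arg_cong[of _ _ "\<lambda>t. (-1) ^ k * t"], rule cancel) auto
    finally show "(-1) ^ n * (f $ m * ((1 - fps_X) ^ n * Y_fps ^ m) $ (n - k)) = \<dots>" .
  qed
  also have "\<dots> = matA x \<nu> n k"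
    using assms by (simp add: matA_def hyp_poly_def sum_distrib_left mult.assoc)
  finally show ?thesis by simp
qed

section \<open>The weight as a logarithmic derivative\<close>

definition weight_fps :: "complex \<Rightarrow> complex \<Rightarrow> complex fps" where
  "weight_fps x \<nu> = fps_const (1 - \<nu>) / (1 - fps_X) + fps_const \<nu> / (1 - fps_X * fps_const (1 - x))"

lemma weight_fps_0 [simp]: "weight_fps x \<nu> $ 0 = 1"
  by (simp add: weight_fps_def fps_divide_unit)

lemma one_plus_xY: "(1 - fps_X) * (1 + fps_const x * Y_fps) = 1 - fps_X * fps_const (1 - x)"
proof -
  have "(1 - fps_X) * (1 + fps_const x * Y_fps)
      = (1 - fps_X) + fps_const x * fps_X * ((1 - fps_X) * inverse (1 - fps_X))"
    unfolding Y_fps_def by (simp only: distrib_left mult_1_left mult_1_right mult_ac)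
  also have "\<dots> = 1 - fps_X * fps_const (1 - x)"
    unfolding inverse_one_minus_X by (simp add: algebra_simps flip: fps_const_sub)
  finally show ?thesis .
qed

lemma weight_fps_eq:
  "weight_fps x \<nu> = inverse (1 - fps_X) *
     (fps_const (1 - \<nu>) + fps_const \<nu> * inverse (1 + fps_const x * Y_fps))"
proof -
  have "weight_fps x \<nu> = fps_const (1 - \<nu>) * inverse (1 - fps_X) +
      fps_const \<nu> * inverse (1 - fps_X * fps_const (1 - x))"
    by (simp add: weight_fps_def fps_divide_unit)
  also have "inverse (1 - fps_X * fps_const (1 - x))
      = inverse (1 - fps_X) * inverse (1 + fps_const x * Y_fps)"
    by (simp only: one_plus_xY[symmetric] fps_inverse_mult)
  finally show ?thesis
    by (simp only: distrib_left mult_ac)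
qed

lemma deriv_bin_fps:
  "fps_deriv (bin_fps x a)
     = fps_const a * bin_fps x a * inverse (1 + fps_const x * Y_fps) * (fps_const x * fps_deriv Y_fps)"
proof -
  have "fps_deriv (bin_fps x a) = (fps_deriv (fps_binomial a) oo (fps_const x * Y_fps))
      * fps_deriv (fps_const x * Y_fps)"
    unfolding bin_fps_def by (rule fps_compose_deriv) simp
  also have "fps_deriv (fps_binomial a) = fps_const a * fps_binomial a * inverse (1 + fps_X)"
    by (simp add: fps_binomial_deriv fps_divide_unit)
  also have "\<dots> oo (fps_const x * Y_fps)
      = fps_const a * bin_fps x a * inverse (1 + fps_const x * Y_fps)"
    by (simp add: fps_compose_mult_distrib fps_inverse_compose fps_compose_add_distrib bin_fps_def)
  finally show ?thesis by simp
qed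

text \<open>Logarithmic differentiation of \<open>\<Xi> = - y (1 + x y) powr (- \<nu>)\<close>: the factor \<open>y\<close> contributes
  \<open>z y' / y = J\<close> with \<open>J = 1 / (1 - z)\<close>, the power contributes \<open>- \<nu> J x y V\<close> with
  \<open>V = 1 / (1 + x y)\<close>, and \<open>x y V = 1 - V\<close>. The sum \<open>J (1 - \<nu> + \<nu> V)\<close> is the weight, because
  \<open>J V = 1 / (1 - z (1 - x))\<close>.\<close>

lemma weight_mult_Xi: "weight_fps x \<nu> * Xi_fps x \<nu> = fps_X * fps_deriv (Xi_fps x \<nu>)"
proof -
  define J where "J = inverse (1 - fps_X :: complex fps)"
  define V where "V = inverse (1 + fps_const x * Y_fps)"
  define b where "b = bin_fps x (- \<nu>)"
  have Xi: "Xi_fps x \<nu> = - (Y_fps * b)"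
    by (simp add: Xi_fps_def H_fps_def Y_fps_def b_def)
  have Y: "Y_fps = fps_X * J" by (simp add: Y_fps_def J_def)
  have J1: "J = 1 + fps_X * J"
    using inverse_one_minus_X by (simp add: J_def algebra_simps)
  have dJ: "fps_deriv J = J * J"
    by (simp add: J_def fps_inverse_deriv power2_eq_square)
  have dY: "fps_deriv Y_fps = J * J"
  proof -
    have "fps_deriv Y_fps = J * (1 + fps_X * J)"
      by (simp add: Y dJ algebra_simps)
    thus ?thesis using J1 by simp
  qed
  have V: "V * (1 + fps_const x * Y_fps) = 1"
    unfolding V_def by (rule inverse_mult_eq_1) simp
  hence V1: "fps_const x * Y_fps * V = 1 - V"
    by (simp add: algebra_simps eq_diff_eq)
  have db: "fps_deriv b = - (fps_const \<nu> * b * V * (fps_const x * (J * J)))"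
    by (simp add: b_def deriv_bin_fps V_def dY del: fps_const_neg flip: fps_const_neg)
  have "fps_deriv (Xi_fps x \<nu>) = - (J * J * b) + fps_const \<nu> * J * b * J * (fps_const x * Y_fps * V)"
    by (simp add: Xi db dY algebra_simps del: fps_const_mult)
  also have "\<dots> = - (J * J * b * (fps_const (1 - \<nu>) + fps_const \<nu> * V))"
    unfolding V1 by (simp add: algebra_simps flip: fps_const_sub)
  finally have dXi: "fps_deriv (Xi_fps x \<nu>)
      = - (J * J * b * (fps_const (1 - \<nu>) + fps_const \<nu> * V))" .
  have w: "weight_fps x \<nu> = J * (fps_const (1 - \<nu>) + fps_const \<nu> * V)"
    by (simp only: weight_fps_eq J_def V_def)
  show ?thesis
    unfolding dXi w unfolding Xi Y by (simp only: mult_minus_left mult_minus_right mult_ac)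
qed

section \<open>Analytic expansions and local inverses\<close>

text \<open>The base of the power in \<open>Xi\<close> is \<open>1 / (1 + x y)\<close>; near 0 it stays away from the branch cut,
  so that the exponent may change sign and the binomial series applies.\<close>

lemma Xi_has_expansion: "Xi x \<nu> has_fps_expansion Xi_fps x \<nu>"
proof -
  let ?u = "\<lambda>z. x * (z * inverse (1 - z))"
  have u: "?u has_fps_expansion fps_const x * Y_fps"
    unfolding Y_fps_def by (intro fps_expansion_intros) auto
  have "((\<lambda>w. (1 + w) powr (- \<nu>)) \<circ> ?u) has_fps_expansion bin_fps x (- \<nu>)"
    unfolding bin_fps_def by (intro fps_expansion_intros u) auto
  hence "(\<lambda>z. z * - (inverse (1 - z) * (1 + ?u z) powr (- \<nu>))) has_fps_expansion Xi_fps x \<nu>"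
    unfolding Xi_fps_def H_fps_def o_def by (intro fps_expansion_intros) auto
  moreover have "eventually (\<lambda>z. z * - (inverse (1 - z) * (1 + ?u z) powr (- \<nu>)) = Xi x \<nu> z) (nhds 0)"
  proof -
    have "continuous (at 0) (\<lambda>z. 1 + ?u z)"
      by (intro continuous_intros) auto
    hence "eventually (\<lambda>z. 1 + ?u z \<in> - \<real>\<^sub>\<le>\<^sub>0) (nhds 0)"
      by (intro eventually_nhds_in_open[of "- \<real>\<^sub>\<le>\<^sub>0", THEN eventually_compose_filterlim])
         (auto simp: continuous_at isCont_def tendsto_nhds_iff)
    moreover have "eventually (\<lambda>z::complex. z \<in> - {1}) (nhds 0)"
      by (intro eventually_nhds_in_open) auto
    ultimately show ?thesis
    proof eventually_elim
      case (elim z)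
      hence z: "z \<noteq> 1" and pos: "1 + ?u z \<notin> \<real>\<^sub>\<le>\<^sub>0" by auto
      have "(1 - z) / (1 - z * (1 - x)) = inverse (1 + ?u z)"
        using z by (simp add: field_simps)
      hence "((1 - z) / (1 - z * (1 - x))) powr \<nu> = (1 + ?u z) powr (- \<nu>)"
        using pos by (auto simp: powr_def Ln_inverse)
      thus ?case
        using z by (simp add: Xi_def field_simps)
    qed
  qed
  ultimately show ?thesis
    by (subst (asm) has_fps_expansion_cong) auto
qed

text \<open>The holomorphic inverse function theorem, with the two neighbourhoods taken to be a ball on
  which \<open>f\<close> is injective and its image.\<close>

lemma local_inverse_exists:
  assumes f: "f has_fps_expansion F" and F: "F $ 0 = 0" "F $ 1 \<noteq> 0"
  shows "\<exists>g. local_inverse_at_0 f g"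
proof -
  have f0: "f 0 = 0"
    using has_fps_expansion_imp_0_eq_fps_nth_0[OF f] F by simp
  have F1: "deriv f 0 = F $ 1"
    using fps_nth_fps_expansion[OF f, of 1] by simp
  obtain S where S: "open S" "0 \<in> S" "f holomorphic_on S"
    using has_fps_expansion_imp_analytic_0[OF f] analytic_at by blast
  obtain r where r: "r > 0" "ball 0 r \<subseteq> S" "inj_on f (ball 0 r)"
    using has_complex_derivative_locally_injective[OF S(3,2,1)] F1 F by metis
  have hol: "f holomorphic_on ball 0 r"
    using S(3) r(2) holomorphic_on_subset by blast
  obtain g where g: "g holomorphic_on (f ` ball 0 r)" "\<And>z. z \<in> ball 0 r \<Longrightarrow> g (f z) = z"
    using holomorphic_has_inverse[OF hol open_ball r(3)] by metis
  have op: "open (f ` ball 0 r)"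
    by (rule open_mapping_thm3[OF hol open_ball r(3)])
  have mem: "0 \<in> f ` ball 0 r"
    using f0 r(1) by (metis centre_in_ball imageI)
  have "g analytic_on {0}"
    using g(1) op mem analytic_at by blast
  moreover have "g 0 = 0" using g(2)[of 0] f0 r(1) by simp
  moreover have "\<forall>z\<in>ball 0 r. \<forall>\<xi>\<in>f ` ball 0 r. f z = \<xi> \<longleftrightarrow> z = g \<xi>"
    using g(2) by (metis imageE)
  ultimately have "local_inverse_at_0 f g"
    unfolding local_inverse_at_0_def using op mem r(1) by (meson centre_in_ball open_ball)
  thus ?thesis by blast
qed

text \<open>By continuity \<open>g\<close> maps a neighbourhood of 0 into the domain on which it inverts \<open>f\<close>, so that
  \<open>f \<circ> g\<close> is the identity near 0; then expansions are compared.\<close>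

lemma local_inverse_expansion:
  assumes f: "f has_fps_expansion F" and g: "local_inverse_at_0 f g"
  shows "fps_expansion g 0 $ 0 = 0" and "F oo fps_expansion g 0 = fps_X"
proof -
  obtain U V where UV: "open U" "0 \<in> U" "open V" "0 \<in> V"
      "\<And>z \<xi>. z \<in> U \<Longrightarrow> \<xi> \<in> V \<Longrightarrow> f z = \<xi> \<longleftrightarrow> z = g \<xi>"
    and an: "g analytic_on {0}" and g0: "g 0 = 0"
    using g unfolding local_inverse_at_0_def by blast
  have G: "g has_fps_expansion fps_expansion g 0"
    by (rule analytic_at_imp_has_fps_expansion_0[OF an])
  show G0: "fps_expansion g 0 $ 0 = 0"
    by (simp add: fps_expansion_def g0)
  have "isCont g 0"
    using an analytic_at_imp_isCont by blast
  hence "filterlim g (nhds 0) (nhds 0)"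
    using g0 by (simp add: isCont_def tendsto_nhds_iff)
  hence "eventually (\<lambda>\<xi>. g \<xi> \<in> U) (nhds 0)"
    by (rule eventually_compose_filterlim[OF eventually_nhds_in_open[OF UV(1,2)]])
  moreover have "eventually (\<lambda>\<xi>. \<xi> \<in> V) (nhds 0)"
    by (rule eventually_nhds_in_open[OF UV(3,4)])
  ultimately have "eventually (\<lambda>\<xi>. (f \<circ> g) \<xi> = \<xi>) (nhds 0)"
    by eventually_elim (use UV(5) in auto)
  moreover have "(f \<circ> g) has_fps_expansion (F oo fps_expansion g 0)"
    by (rule has_fps_expansion_compose[OF f G G0])
  ultimately have "(\<lambda>\<xi>. \<xi>) has_fps_expansion (F oo fps_expansion g 0)"
    by (subst (asm) has_fps_expansion_cong) auto
  thus "F oo fps_expansion g 0 = fps_X"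
    using fps_expansion_unique_complex has_fps_expansion_fps_X by blast
qed

section \<open>Column generating series and the inverse pair of matrices\<close>

text \<open>Column \<open>k\<close> of \<open>B\<close> has generating series \<open>weight * \<Xi>^k\<close>: by \<open>weight_mult_Xi\<close> this is
  \<open>(1 / k) z (d/dz) \<Xi>^k\<close>, where the operator \<open>z (d/dz)\<close> supplies the factor \<open>n\<close> of \<open>matB_eq\<close>.\<close>

lemma gen_series_matB:
  assumes "\<forall>n\<ge>1. S n = lower_mult (matB x \<nu>) T n"
  shows "gen_series S = weight_fps x \<nu> * (gen_series T oo Xi_fps x \<nu>)"
proof (rule fps_ext)
  fix n
  show "gen_series S $ n = (weight_fps x \<nu> * (gen_series T oo Xi_fps x \<nu>)) $ n"
  proof (cases "n = 0")
    case True
    thus ?thesis by (simp add: gen_series_def)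
  next
    case False
    have col: "(weight_fps x \<nu> * Xi_fps x \<nu> ^ k) $ n = matB x \<nu> n k" if k: "1 \<le> k" for k
    proof -
      obtain k' where k': "k = Suc k'" using k by (cases k) auto
      have "of_nat k * (weight_fps x \<nu> * Xi_fps x \<nu> ^ k)
          = of_nat k * (weight_fps x \<nu> * Xi_fps x \<nu>) * Xi_fps x \<nu> ^ k'"
        by (simp add: k' mult_ac)
      also have "\<dots> = fps_X * fps_deriv (Xi_fps x \<nu> ^ k)"
        unfolding weight_mult_Xi fps_deriv_power' by (simp add: k' mult_ac)
      finally have "(of_nat k * (weight_fps x \<nu> * Xi_fps x \<nu> ^ k)) $ n
          = of_nat n * (Xi_fps x \<nu> ^ k) $ n"
        using False by simp
      hence "of_nat k * (weight_fps x \<nu> * Xi_fps x \<nu> ^ k) $ n = of_nat n * (Xi_fps x \<nu> ^ k) $ n"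
        by (simp add: fps_of_nat[symmetric] del: fps_of_nat)
      thus ?thesis using k False by (simp add: matB_eq field_simps)
    qed
    have "(weight_fps x \<nu> * (gen_series T oo Xi_fps x \<nu>)) $ n
        = (\<Sum>k=0..n. gen_series T $ k * (weight_fps x \<nu> * Xi_fps x \<nu> ^ k) $ n)"
      by (rule mult_compose_nth) simp
    also have "\<dots> = (\<Sum>k=1..n. matB x \<nu> n k * T k)"
      by (rule sum.mono_neutral_cong_right) (auto simp: gen_series_def col)
    finally show ?thesis
      using assms False by (simp add: gen_series_def lower_mult_def)
  qed
qed

lemma matA_matB:
  assumes "1 \<le> k" "k \<le> n"
  shows "(\<Sum>j=1..n. matA x \<nu> n j * matB x \<nu> j k) = (if n = k then 1 else 0)"
proof -
  have "(\<Sum>j=1..n. matA x \<nu> n j * matB x \<nu> j k)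
      = (\<Sum>j=1..n. (of_nat j * (Xi_fps x \<nu> ^ k) $ j / of_nat k) * (G_fps x \<nu> ^ n) $ (n - j))"
    using assms by (intro sum.cong) (auto simp: matA_eq matB_eq)
  also have "\<dots> = (\<Sum>j=1..n. (fps_X * fps_deriv (Xi_fps x \<nu> ^ k)) $ j * (G_fps x \<nu> ^ n) $ (n - j)) / of_nat k"
    unfolding sum_divide_distrib by (intro sum.cong) auto
  also have "(\<Sum>j=1..n. (fps_X * fps_deriv (Xi_fps x \<nu> ^ k)) $ j * (G_fps x \<nu> ^ n) $ (n - j))
      = (\<Sum>j=0..n. (fps_X * fps_deriv (Xi_fps x \<nu> ^ k)) $ j * (G_fps x \<nu> ^ n) $ (n - j))"
    by (intro sum.mono_neutral_left) (auto simp: not_less_eq_eq)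
  also have "\<dots> = (G_fps x \<nu> ^ n * (fps_X * fps_deriv (Xi_fps x \<nu> ^ k))) $ n"
    by (subst mult.commute) (rule fps_mult_nth[symmetric])
  also have "\<dots> = (if n = k then of_nat k else 0)"
    unfolding Xi_fps_def by (rule lagrange_biorthogonality[OF G_H assms])
  finally show ?thesis using assms by auto
qed

lemma matA_lower_mult_matB:
  assumes "1 \<le> n"
  shows "lower_mult (matA x \<nu>) (lower_mult (matB x \<nu>) T) n = T n"
proof -
  have "lower_mult (matA x \<nu>) (lower_mult (matB x \<nu>) T) n
      = (\<Sum>j=1..n. matA x \<nu> n j * (\<Sum>k=1..n. matB x \<nu> j k * T k))"
    unfolding lower_mult_def
    by (intro sum.cong refl arg_cong[where f = "\<lambda>t. _ * t"] sum.mono_neutral_left)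
       (auto simp: matB_def)
  also have "\<dots> = (\<Sum>k=1..n. \<Sum>j=1..n. matA x \<nu> n j * matB x \<nu> j k * T k)"
    unfolding sum_distrib_left by (subst sum.swap) (simp only: mult.assoc)
  also have "\<dots> = (\<Sum>k=1..n. if n = k then T k else 0)"
    unfolding sum_distrib_right[symmetric] by (intro sum.cong refl, subst matA_matB) auto
  also have "\<dots> = T n"
    using assms by simp
  finally show ?thesis .
qed

text \<open>The diagonal entries of \<open>A\<close> are \<open>(-1)^n\<close>, so a system with this matrix can be solved by
  forward substitution. This turns the left inverse \<open>A\<close> of \<open>B\<close> into a two-sided one.\<close>

lemma matA_lower_mult_inj:
  assumes eq: "\<And>n. 1 \<le> n \<Longrightarrow> lower_mult (matA x \<nu>) S n = lower_mult (matA x \<nu>) S' n"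
    and "1 \<le> n"
  shows "S n = S' n"
  using \<open>1 \<le> n\<close>
proof (induction n rule: less_induct)
  case (less n)
  have split: "lower_mult (matA x \<nu>) R n
      = (\<Sum>k=1..<n. matA x \<nu> n k * R k) + (-1) ^ n * R n" for R
  proof -
    have "{1..n} = insert n {1..<n}" using less.prems by auto
    thus ?thesis using less.prems
      by (simp add: lower_mult_def matA_def hyp_poly_def add.commute)
  qed
  have "(\<Sum>k=1..<n. matA x \<nu> n k * S k) = (\<Sum>k=1..<n. matA x \<nu> n k * S' k)"
    using less.IH by (intro sum.cong) auto
  thus ?case using eq[OF less.prems] unfolding split by simp
qed

lemma weight_compose:
  assumes "Q $ 0 = 0"
  shows "weight_fps x \<nu> oo Q = fps_const (1 - \<nu>) / (1 - Q) + fps_const \<nu> / (1 - fps_const (1 - x) * Q)"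
proof -
  have w: "weight_fps x \<nu> = fps_const (1 - \<nu>) * inverse (1 - fps_X) +
      fps_const \<nu> * inverse (1 - fps_X * fps_const (1 - x))"
    by (simp add: weight_fps_def fps_divide_unit)
  have "weight_fps x \<nu> oo Q = fps_const (1 - \<nu>) * inverse (1 - Q) +
      fps_const \<nu> * inverse (1 - Q * fps_const (1 - x))"
    unfolding w using assms
    by (simp add: fps_compose_add_distrib fps_compose_mult_distrib fps_inverse_compose
        fps_compose_sub_distrib del: fps_const_sub)
  thus ?thesis using assms by (simp add: fps_divide_unit mult.commute)
qed

section \<open>Generating series under the inversion formula\<close>

theorem corollary3p1:
  fixes x \<nu> :: complex and S T :: "nat \<Rightarrow> complex"
  shows
    "((\<forall>n\<ge>1. S n = lower_mult (matB x \<nu>) T n) \<longleftrightarrow> (\<forall>n\<ge>1. T n = lower_mult (matA x \<nu>) S n)) \<and>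
     ((\<forall>n\<ge>1. S n = lower_mult (matB x \<nu>) T n) \<longrightarrow>
        gen_series S =
          (fps_const (1 - \<nu>) / (1 - fps_X) + fps_const \<nu> / (1 - fps_X * fps_const (1 - x)))
          * (gen_series T oo fps_expansion (Xi x \<nu>) 0)
      \<and> (\<exists>\<Omega>. local_inverse_at_0 (Xi x \<nu>) \<Omega>)
      \<and> (\<forall>\<Omega>. local_inverse_at_0 (Xi x \<nu>) \<Omega> \<longrightarrow>
           gen_series T =
             (gen_series S oo fps_expansion \<Omega> 0)
             * inverse (fps_const (1 - \<nu>) / (1 - fps_expansion \<Omega> 0)
                        + fps_const \<nu> / (1 - fps_const (1 - x) * fps_expansion \<Omega> 0))))"
proof (intro conjI impI allI)
  note Xi = Xi_has_expansion[of x \<nu>]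
  have Xi_eq: "fps_expansion (Xi x \<nu>) 0 = Xi_fps x \<nu>"
    by (rule fps_expansion_eqI[OF Xi])
  have A_cong: "lower_mult (matA x \<nu>) R n = lower_mult (matA x \<nu>) R' n"
    if "\<forall>k\<ge>1. R k = R' k" for R R' n
    using that by (simp add: lower_mult_def)
  show "(\<forall>n\<ge>1. S n = lower_mult (matB x \<nu>) T n) \<longleftrightarrow> (\<forall>n\<ge>1. T n = lower_mult (matA x \<nu>) S n)"
  proof
    assume S: "\<forall>n\<ge>1. S n = lower_mult (matB x \<nu>) T n"
    show "\<forall>n\<ge>1. T n = lower_mult (matA x \<nu>) S n"
      using A_cong[OF S] by (simp add: matA_lower_mult_matB)
  next
    assume T: "\<forall>n\<ge>1. T n = lower_mult (matA x \<nu>) S n"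
    show "\<forall>n\<ge>1. S n = lower_mult (matB x \<nu>) T n"
    proof (intro allI impI)
      fix n :: nat assume "1 \<le> n"
      thus "S n = lower_mult (matB x \<nu>) T n"
        by (rule matA_lower_mult_inj[where x = x and \<nu> = \<nu>, rotated]) (use T in \<open>simp add: matA_lower_mult_matB\<close>)
    qed
  qed
  assume S: "\<forall>n\<ge>1. S n = lower_mult (matB x \<nu>) T n"
  have gS: "gen_series S = weight_fps x \<nu> * (gen_series T oo Xi_fps x \<nu>)"
    by (rule gen_series_matB[OF S])
  show "gen_series S =
          (fps_const (1 - \<nu>) / (1 - fps_X) + fps_const \<nu> / (1 - fps_X * fps_const (1 - x)))
          * (gen_series T oo fps_expansion (Xi x \<nu>) 0)"
    using gS unfolding Xi_eq weight_fps_def .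
  have "Xi_fps x \<nu> $ 1 \<noteq> 0"
    by (simp add: Xi_fps_def H_fps_def)
  thus "\<exists>\<Omega>. local_inverse_at_0 (Xi x \<nu>) \<Omega>"
    by (intro local_inverse_exists[OF Xi]) auto
  fix \<Omega> assume "local_inverse_at_0 (Xi x \<nu>) \<Omega>"
  note \<Omega> = local_inverse_expansion[OF Xi this]
  let ?O = "fps_expansion \<Omega> 0"
  have "gen_series S oo ?O = (weight_fps x \<nu> oo ?O) * (gen_series T oo (Xi_fps x \<nu> oo ?O))"
    unfolding gS using \<Omega>(1) by (simp add: fps_compose_mult_distrib fps_compose_assoc)
  hence comp: "gen_series S oo ?O = (weight_fps x \<nu> oo ?O) * gen_series T"
    by (simp add: \<Omega>(2))
  have "gen_series T = gen_series T * ((weight_fps x \<nu> oo ?O) * inverse (weight_fps x \<nu> oo ?O))"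
    by (subst inverse_mult_eq_1') auto
  also have "\<dots> = (gen_series S oo ?O) * inverse (weight_fps x \<nu> oo ?O)"
    unfolding comp by (simp only: mult_ac)
  finally show "gen_series T = (gen_series S oo ?O)
       * inverse (fps_const (1 - \<nu>) / (1 - ?O) + fps_const \<nu> / (1 - fps_const (1 - x) * ?O))"
    unfolding weight_compose[OF \<Omega>(1)] .
qed

end
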